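(* Let $\mathcal{A}$ be a noetherian abelian category. Then the map $$\mathcal{X}\mapsto \bigcup_{M\in\mathcal{X}}\operatorname{ASupp} M$$ gives a one-to-one correspondence between Serre subcategories of $\mathcal{A}$ and open subsets of the atom spectrum $\operatorname{ASpec}\mathcal{A}$. The inverse is given by $$\Phi\mapsto\{M\in\mathcal{A}\mid \operatorname{ASupp} M\subset\Phi\}.$$
   Context: Conventions: a subcategory means a full subcategory which contains zero objects and is closed under isomorphisms. An abelian category is noetherian if every object in it is noetherian (every ascending chain of subobjects stabilizes) and it is skeletally small. A Serre subcategory of $\mathcal{A}$ is a subcategory closed under subobjects, quotient objects, and extensions. A nonzero object $H$ of an abelian category $\mathcal{A}$ is a monoform object if for every nonzero subobject $N$ of $H$ there does not exist a nonzero subobject of $H$ which is isomorphic to a subobject of $H/N$. Monoform objects $H$ and $H'$ are atom-equivalent if there exists a common nonzero subobject of $H$ and $H'$, i.e. a nonzero object isomorphic to a subobject of $H$ and to a subobject of $H'$; this is an equivalence relation on monoform objects. The atom spectrum $\operatorname{ASpec}\mathcal{A}$ is the collection of equivalence classes of monoform objects in $\mathcal{A}$ (it is a set when $\mathcal{A}$ is noetherian); the class of $H$ is denoted $\overline{H}$ and called the atom of $H$. A subquotient of an object $M$ is a subobject of a quotient object of $M$ (equivalently, a quotient object of a subobject of $M$). For an object $M$, its atom support is $$\operatorname{ASupp}M=\{\overline{H}\in\operatorname{ASpec}\mathcal{A}\mid \text{there exists } H'\in\overline{H}\text{ which is a subquotient of }M\}.$$ A subset $\Phi\subset\operatorname{ASpec}\mathcal{A}$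 is open if for any $\overline{H}\in\Phi$ there exists $H'\in\overline{H}$ such that $\operatorname{ASupp}H'\subset\Phi$. This defines a topology on $\operatorname{ASpec}\mathcal{A}$. *)

theory Defs
  imports "HOL-Algebra.Group"
begin

section \<open>Abelian categories\<close>

text \<open>
  All fields are only meaningful on objects and arrows; \<open>g \<cdot>\<^bsub>A\<^esub> f\<close> is ``\<open>g\<close> after \<open>f\<close>'' and
  \<open>add_arr\<close> is addition of parallel arrows.
\<close>

record ('o, 'm) cat_data =
  Obj :: "'o set"
  Arr :: "'m set"
  Dom :: "'m \<Rightarrow> 'o"
  Cod :: "'m \<Rightarrow> 'o"
  ident :: "'o \<Rightarrow> 'm"
  comp_arr :: "'m \<Rightarrow> 'm \<Rightarrow> 'm"  (infixl "\<cdot>\<index>" 70)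
  add_arr :: "'m \<Rightarrow> 'm \<Rightarrow> 'm"
  zero_arr :: "'o \<Rightarrow> 'o \<Rightarrow> 'm"

definition Hom :: "('o, 'm) cat_data \<Rightarrow> 'o \<Rightarrow> 'o \<Rightarrow> 'm set" where
  "Hom A X Y = {f \<in> Arr A. Dom A f = X \<and> Cod A f = Y}"

definition hom_group :: "('o, 'm) cat_data \<Rightarrow> 'o \<Rightarrow> 'o \<Rightarrow> 'm monoid" where
  "hom_group A X Y = \<lparr>carrier = Hom A X Y, monoid.mult = add_arr A, one = zero_arr A X Y\<rparr>"

locale category =
  fixes A :: "('o, 'm) cat_data" (structure)
  assumes Dom_in_Obj: "f \<in> Arr A \<Longrightarrow> Dom A f \<in> Obj A"
    and Cod_in_Obj: "f \<in> Arr A \<Longrightarrow> Cod A f \<in> Obj A"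
    and ident_in_Hom: "X \<in> Obj A \<Longrightarrow> ident A X \<in> Hom A X X"
    and comp_in_Hom: "f \<in> Hom A X Y \<Longrightarrow> g \<in> Hom A Y Z \<Longrightarrow> g \<cdot> f \<in> Hom A X Z"
    and ident_left: "f \<in> Hom A X Y \<Longrightarrow> ident A Y \<cdot> f = f"
    and ident_right: "f \<in> Hom A X Y \<Longrightarrow> f \<cdot> ident A X = f"
    and comp_assoc: "f \<in> Hom A W X \<Longrightarrow> g \<in> Hom A X Y \<Longrightarrow> h \<in> Hom A Y Z \<Longrightarrow>
      h \<cdot> (g \<cdot> f) = (h \<cdot> g) \<cdot> f"

locale preadditive_category = category +
  assumes hom_comm_group: "X \<in> Obj A \<Longrightarrow> Y \<in> Obj A \<Longrightarrow> comm_group (hom_group A X Y)"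
    and comp_add_right: "f \<in> Hom A X Y \<Longrightarrow> g \<in> Hom A X Y \<Longrightarrow> h \<in> Hom A Y Z \<Longrightarrow>
      h \<cdot> add_arr A f g = add_arr A (h \<cdot> f) (h \<cdot> g)"
    and comp_add_left: "f \<in> Hom A X Y \<Longrightarrow> g \<in> Hom A Y Z \<Longrightarrow> h \<in> Hom A Y Z \<Longrightarrow>
      add_arr A g h \<cdot> f = add_arr A (g \<cdot> f) (h \<cdot> f)"

definition monic :: "('o, 'm) cat_data \<Rightarrow> 'm \<Rightarrow> bool" where
  "monic A i \<longleftrightarrow> i \<in> Arr A \<and>
    (\<forall>W. \<forall>f \<in> Hom A W (Dom A i). \<forall>g \<in> Hom A W (Dom A i). i \<cdot>\<^bsub>A\<^esub> f = i \<cdot>\<^bsub>A\<^esub> g \<longrightarrow> f = g)"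

definition epic :: "('o, 'm) cat_data \<Rightarrow> 'm \<Rightarrow> bool" where
  "epic A p \<longleftrightarrow> p \<in> Arr A \<and>
    (\<forall>W. \<forall>f \<in> Hom A (Cod A p) W. \<forall>g \<in> Hom A (Cod A p) W. f \<cdot>\<^bsub>A\<^esub> p = g \<cdot>\<^bsub>A\<^esub> p \<longrightarrow> f = g)"

definition isomorphic :: "('o, 'm) cat_data \<Rightarrow> 'o \<Rightarrow> 'o \<Rightarrow> bool" where
  "isomorphic A X Y \<longleftrightarrow> (\<exists>f \<in> Hom A X Y. \<exists>g \<in> Hom A Y X.
    g \<cdot>\<^bsub>A\<^esub> f = ident A X \<and> f \<cdot>\<^bsub>A\<^esub> g = ident A Y)"

definition zero_object :: "('o, 'm) cat_data \<Rightarrow> 'o \<Rightarrow> bool" where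
  "zero_object A Z \<longleftrightarrow> Z \<in> Obj A \<and>
    (\<forall>X \<in> Obj A. (\<exists>!f. f \<in> Hom A X Z) \<and> (\<exists>!f. f \<in> Hom A Z X))"

definition is_biproduct :: "('o, 'm) cat_data \<Rightarrow> 'o \<Rightarrow> 'o \<Rightarrow> 'o \<Rightarrow> 'm \<Rightarrow> 'm \<Rightarrow> 'm \<Rightarrow> 'm \<Rightarrow> bool" where
  "is_biproduct A X Y S i j p q \<longleftrightarrow>
    i \<in> Hom A X S \<and> j \<in> Hom A Y S \<and> p \<in> Hom A S X \<and> q \<in> Hom A S Y \<and>
    p \<cdot>\<^bsub>A\<^esub> i = ident A X \<and> q \<cdot>\<^bsub>A\<^esub> j = ident A Y \<and>
    q \<cdot>\<^bsub>A\<^esub> i = zero_arr A X Y \<and> p \<cdot>\<^bsub>A\<^esub> j = zero_arr A Y X \<and>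
    add_arr A (i \<cdot>\<^bsub>A\<^esub> p) (j \<cdot>\<^bsub>A\<^esub> q) = ident A S"

definition is_kernel :: "('o, 'm) cat_data \<Rightarrow> 'm \<Rightarrow> 'm \<Rightarrow> bool" where
  "is_kernel A k f \<longleftrightarrow> k \<in> Arr A \<and> f \<in> Arr A \<and> Cod A k = Dom A f \<and>
    f \<cdot>\<^bsub>A\<^esub> k = zero_arr A (Dom A k) (Cod A f) \<and>
    (\<forall>W. \<forall>t \<in> Hom A W (Dom A f). f \<cdot>\<^bsub>A\<^esub> t = zero_arr A W (Cod A f) \<longrightarrow>
      (\<exists>!h. h \<in> Hom A W (Dom A k) \<and> k \<cdot>\<^bsub>A\<^esub> h = t))"

definition is_cokernel :: "('o, 'm) cat_data \<Rightarrow> 'm \<Rightarrow> 'm \<Rightarrow> bool" where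
  "is_cokernel A c f \<longleftrightarrow> c \<in> Arr A \<and> f \<in> Arr A \<and> Dom A c = Cod A f \<and>
    c \<cdot>\<^bsub>A\<^esub> f = zero_arr A (Dom A f) (Cod A c) \<and>
    (\<forall>W. \<forall>t \<in> Hom A (Cod A f) W. t \<cdot>\<^bsub>A\<^esub> f = zero_arr A (Dom A f) W \<longrightarrow>
      (\<exists>!h. h \<in> Hom A (Cod A c) W \<and> h \<cdot>\<^bsub>A\<^esub> c = t))"

locale abelian_category = preadditive_category +
  assumes zero_object_exists: "\<exists>Z. zero_object A Z"
    and biproduct_exists: "X \<in> Obj A \<Longrightarrow> Y \<in> Obj A \<Longrightarrow> \<exists>S i j p q. is_biproduct A X Y S i j p q"
    and kernel_exists: "f \<in> Arr A \<Longrightarrow> \<exists>k. is_kernel A k f"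
    and cokernel_exists: "f \<in> Arr A \<Longrightarrow> \<exists>c. is_cokernel A c f"
    and monic_is_kernel: "monic A i \<Longrightarrow> \<exists>f. is_kernel A i f"
    and epic_is_cokernel: "epic A p \<Longrightarrow> \<exists>f. is_cokernel A p f"


section \<open>Subobjects, noetherian objects, Serre subcategories\<close>

text \<open>
  A subobject of \<open>M\<close> is represented by any monomorphism into \<open>M\<close>, a quotient object by any
  epimorphism out of \<open>M\<close>. Thus \<open>subobject A N M\<close> (for objects) says that \<open>N\<close> carries the
  structure of a subobject of \<open>M\<close>, which includes every object isomorphic to a subobject.
\<close>

definition subobject :: "('o, 'm) cat_data \<Rightarrow> 'o \<Rightarrow> 'o \<Rightarrow> bool" where
  "subobject A N M \<longleftrightarrow> (\<exists>i \<in> Hom A N M. monic A i)"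

definition quotient_object :: "('o, 'm) cat_data \<Rightarrow> 'o \<Rightarrow> 'o \<Rightarrow> bool" where
  "quotient_object A Q M \<longleftrightarrow> (\<exists>p \<in> Hom A M Q. epic A p)"

definition subquotient :: "('o, 'm) cat_data \<Rightarrow> 'o \<Rightarrow> 'o \<Rightarrow> bool" where
  "subquotient A L M \<longleftrightarrow> (\<exists>Q. quotient_object A Q M \<and> subobject A L Q)"

text \<open>Containment of the subobjects of a fixed object represented by the monomorphisms \<open>i\<close> and \<open>j\<close>.\<close>

definition sub_le :: "('o, 'm) cat_data \<Rightarrow> 'm \<Rightarrow> 'm \<Rightarrow> bool" where
  "sub_le A i j \<longleftrightarrow> (\<exists>h \<in> Hom A (Dom A i) (Dom A j). j \<cdot>\<^bsub>A\<^esub> h = i)"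

definition noetherian_object :: "('o, 'm) cat_data \<Rightarrow> 'o \<Rightarrow> bool" where
  "noetherian_object A M \<longleftrightarrow> M \<in> Obj A \<and>
    (\<forall>u :: nat \<Rightarrow> 'm.
      (\<forall>n. monic A (u n) \<and> Cod A (u n) = M) \<and> (\<forall>n. sub_le A (u n) (u (Suc n))) \<longrightarrow>
      (\<exists>m. \<forall>n \<ge> m. sub_le A (u m) (u n) \<and> sub_le A (u n) (u m)))"

text \<open>
  Skeletal smallness needs no assumption: the isomorphism classes of objects form a set because
  the objects themselves do.
\<close>

locale noetherian_abelian_category = abelian_category +
  assumes noetherian: "M \<in> Obj A \<Longrightarrow> noetherian_object A M"

text \<open>A full subcategory is identified with its class of objects.\<close>

definition subcategory :: "('o, 'm) cat_data \<Rightarrow> 'o set \<Rightarrow> bool" where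
  "subcategory A \<X> \<longleftrightarrow> \<X> \<subseteq> Obj A \<and> (\<forall>Z. zero_object A Z \<longrightarrow> Z \<in> \<X>) \<and>
    (\<forall>M N. M \<in> \<X> \<and> isomorphic A M N \<longrightarrow> N \<in> \<X>)"

definition short_exact :: "('o, 'm) cat_data \<Rightarrow> 'm \<Rightarrow> 'm \<Rightarrow> bool" where
  "short_exact A f g \<longleftrightarrow> is_kernel A f g \<and> is_cokernel A g f"

definition serre_subcategory :: "('o, 'm) cat_data \<Rightarrow> 'o set \<Rightarrow> bool" where
  "serre_subcategory A \<X> \<longleftrightarrow> subcategory A \<X> \<and>
    (\<forall>M N. M \<in> \<X> \<and> subobject A N M \<longrightarrow> N \<in> \<X>) \<and>
    (\<forall>M N. M \<in> \<X> \<and> quotient_object A N M \<longrightarrow> N \<in> \<X>) \<and>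
    (\<forall>f g. short_exact A f g \<and> Dom A f \<in> \<X> \<and> Cod A g \<in> \<X> \<longrightarrow> Cod A f \<in> \<X>)"


section \<open>The atom spectrum\<close>

text \<open>For a monomorphism \<open>i : N \<rightarrow> H\<close>, the quotient \<open>H/N\<close> is the codomain of any cokernel of \<open>i\<close>.\<close>

definition monoform :: "('o, 'm) cat_data \<Rightarrow> 'o \<Rightarrow> bool" where
  "monoform A H \<longleftrightarrow> H \<in> Obj A \<and> \<not> zero_object A H \<and>
    (\<forall>i c. monic A i \<and> Cod A i = H \<and> \<not> zero_object A (Dom A i) \<and> is_cokernel A c i \<longrightarrow>
      \<not> (\<exists>L. \<not> zero_object A L \<and> subobject A L H \<and> subobject A L (Cod A c)))"

definition atom_equiv :: "('o, 'm) cat_data \<Rightarrow> ('o \<times> 'o) set" where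
  "atom_equiv A = {(H, H'). monoform A H \<and> monoform A H' \<and>
    (\<exists>L. \<not> zero_object A L \<and> subobject A L H \<and> subobject A L H')}"

definition ASpec :: "('o, 'm) cat_data \<Rightarrow> 'o set set" where
  "ASpec A = {H. monoform A H} // atom_equiv A"

definition ASupp :: "('o, 'm) cat_data \<Rightarrow> 'o \<Rightarrow> 'o set set" where
  "ASupp A M = {\<alpha> \<in> ASpec A. \<exists>H' \<in> \<alpha>. subquotient A H' M}"

definition open_atoms :: "('o, 'm) cat_data \<Rightarrow> 'o set set \<Rightarrow> bool" where
  "open_atoms A \<Phi> \<longleftrightarrow> \<Phi> \<subseteq> ASpec A \<and> (\<forall>\<alpha> \<in> \<Phi>. \<exists>H' \<in> \<alpha>. ASupp A H' \<subseteq> \<Phi>)"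

end

theory Submission
  imports Defs
begin

text \<open>
  A nonzero noetherian object has a monoform subobject, and \<open>ASupp\<close> of an extension is the union of
  the outer supports because a monoform subobject of the middle either meets the left term or
  embeds into the right one. If \<open>ASupp M\<close> is covered by the supports of a Serre subcategory \<open>\<X>\<close>,
  a monoform subobject of \<open>M\<close> shares a nonzero subobject \<open>L\<close> with a subquotient of an object
  of \<open>\<X>\<close>; so \<open>L \<in> \<X>\<close>, and noetherian induction applied to \<open>M/L\<close> gives \<open>M \<in> \<X>\<close>.
\<close>

section \<open>Arrows in an abelian category\<close>

context category
begin

lemma HomD:
  assumes "f \<in> Hom A X Y"
  shows "f \<in> Arr A" "Dom A f = X" "Cod A f = Y" "X \<in> Obj A" "Y \<in> Obj A"
  using assms Dom_in_Obj Cod_in_Obj by (auto simp: Hom_def)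

lemma Arr_in_Hom: "f \<in> Arr A \<Longrightarrow> f \<in> Hom A (Dom A f) (Cod A f)"
  by (simp add: Hom_def)

lemma monic_cancel:
  assumes "monic A i" "i \<in> Hom A X Y" "f \<in> Hom A W X" "g \<in> Hom A W X" "i \<cdot> f = i \<cdot> g"
  shows "f = g"
  using assms HomD[OF assms(2)] unfolding monic_def by metis

lemma epic_cancel:
  assumes "epic A p" "p \<in> Hom A X Y" "f \<in> Hom A Y W" "g \<in> Hom A Y W" "f \<cdot> p = g \<cdot> p"
  shows "f = g"
  using assms HomD[OF assms(2)] unfolding epic_def by metis

lemma monicI:
  assumes "i \<in> Hom A X Y"
    and "\<And>W f g. f \<in> Hom A W X \<Longrightarrow> g \<in> Hom A W X \<Longrightarrow> i \<cdot> f = i \<cdot> g \<Longrightarrow> f = g"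
  shows "monic A i"
  using assms HomD[OF assms(1)] unfolding monic_def by metis

lemma epicI:
  assumes "p \<in> Hom A X Y"
    and "\<And>W f g. f \<in> Hom A Y W \<Longrightarrow> g \<in> Hom A Y W \<Longrightarrow> f \<cdot> p = g \<cdot> p \<Longrightarrow> f = g"
  shows "epic A p"
  using assms HomD[OF assms(1)] unfolding epic_def by metis

lemma monic_comp:
  assumes "monic A i" "monic A j" "i \<in> Hom A X Y" "j \<in> Hom A Y Z"
  shows "monic A (j \<cdot> i)"
proof (rule monicI)
  show "j \<cdot> i \<in> Hom A X Z" using assms comp_in_Hom by blast
  fix W f g assume f: "f \<in> Hom A W X" and g: "g \<in> Hom A W X" and "(j \<cdot> i) \<cdot> f = (j \<cdot> i) \<cdot> g"
  then have "j \<cdot> (i \<cdot> f) = j \<cdot> (i \<cdot> g)"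
    using comp_assoc[OF f assms(3,4)] comp_assoc[OF g assms(3,4)] by simp
  then have "i \<cdot> f = i \<cdot> g" by (meson assms f g comp_in_Hom monic_cancel)
  then show "f = g" using assms f g monic_cancel by blast
qed

lemma epic_comp:
  assumes "epic A p" "epic A q" "p \<in> Hom A X Y" "q \<in> Hom A Y Z"
  shows "epic A (q \<cdot> p)"
proof (rule epicI)
  show "q \<cdot> p \<in> Hom A X Z" using assms comp_in_Hom by blast
  fix W f g assume f: "f \<in> Hom A Z W" and g: "g \<in> Hom A Z W" and "f \<cdot> (q \<cdot> p) = g \<cdot> (q \<cdot> p)"
  then have "(f \<cdot> q) \<cdot> p = (g \<cdot> q) \<cdot> p"
    using comp_assoc[OF assms(3,4) f] comp_assoc[OF assms(3,4) g] by simp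
  then have "f \<cdot> q = g \<cdot> q" by (meson assms f g comp_in_Hom epic_cancel)
  then show "f = g" using assms f g epic_cancel by blast
qed

lemma epic_of_comp:
  assumes "epic A (q \<cdot> p)" "p \<in> Hom A X Y" "q \<in> Hom A Y Z"
  shows "epic A q"
proof (rule epicI[OF assms(3)])
  fix W f g assume f: "f \<in> Hom A Z W" and g: "g \<in> Hom A Z W" and "f \<cdot> q = g \<cdot> q"
  then have "f \<cdot> (q \<cdot> p) = g \<cdot> (q \<cdot> p)"
    using comp_assoc[OF assms(2,3) f] comp_assoc[OF assms(2,3) g] by simp
  then show "f = g" using epic_cancel[OF assms(1) comp_in_Hom[OF assms(2,3)] f g] by blast
qed

lemma split_monic:
  assumes "e \<in> Hom A X Y" "h \<in> Hom A Y X" "h \<cdot> e = ident A X"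
  shows "monic A e"
proof (rule monicI[OF assms(1)])
  fix W f g assume f: "f \<in> Hom A W X" and g: "g \<in> Hom A W X" and "e \<cdot> f = e \<cdot> g"
  then have "(h \<cdot> e) \<cdot> f = (h \<cdot> e) \<cdot> g"
    using comp_assoc[OF f assms(1,2)] comp_assoc[OF g assms(1,2)] by simp
  then show "f = g" using assms(3) ident_left[OF f] ident_left[OF g] by simp
qed

lemma monic_ident: "X \<in> Obj A \<Longrightarrow> monic A (ident A X)"
  using split_monic ident_in_Hom ident_left by meson

lemma epic_ident: "X \<in> Obj A \<Longrightarrow> epic A (ident A X)"
  by (metis epicI ident_in_Hom ident_right)

end

section \<open>Zero arrows, zero objects, kernels and cokernels\<close>

context preadditive_category
begin

lemma zero_in_Hom: "X \<in> Obj A \<Longrightarrow> Y \<in> Obj A \<Longrightarrow> zero_arr A X Y \<in> Hom A X Y"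
  using monoid.one_closed[of "hom_group A X Y"] hom_comm_group[of X Y]
  by (simp add: hom_group_def comm_group_def comm_monoid_def)

lemma add_self_zero:
  assumes "f \<in> Hom A X Y" "add_arr A f f = f"
  shows "f = zero_arr A X Y"
proof -
  interpret comm_group "hom_group A X Y" using hom_comm_group HomD[OF assms(1)] by blast
  show ?thesis using assms l_cancel_one[of f f] by (simp add: hom_group_def)
qed

lemma zero_add:
  assumes "f \<in> Hom A X Y"
  shows "add_arr A (zero_arr A X Y) f = f"
proof -
  interpret comm_group "hom_group A X Y" using hom_comm_group HomD[OF assms(1)] by blast
  show ?thesis using assms l_one[of f] by (simp add: hom_group_def)
qed

lemma comp_zero:
  assumes "f \<in> Hom A Y Z" "X \<in> Obj A"
  shows "f \<cdot> zero_arr A X Y = zero_arr A X Z"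
proof -
  have z: "zero_arr A X Y \<in> Hom A X Y" using zero_in_Hom HomD[OF assms(1)] assms(2) by blast
  have "add_arr A (f \<cdot> zero_arr A X Y) (f \<cdot> zero_arr A X Y) = f \<cdot> zero_arr A X Y"
    using comp_add_right[OF z z assms(1)] zero_add[OF z] by simp
  then show ?thesis using add_self_zero comp_in_Hom[OF z assms(1)] by blast
qed

lemma zero_comp:
  assumes "f \<in> Hom A X Y" "Z \<in> Obj A"
  shows "zero_arr A Y Z \<cdot> f = zero_arr A X Z"
proof -
  have z: "zero_arr A Y Z \<in> Hom A Y Z" using zero_in_Hom HomD[OF assms(1)] assms(2) by blast
  have "add_arr A (zero_arr A Y Z \<cdot> f) (zero_arr A Y Z \<cdot> f) = zero_arr A Y Z \<cdot> f"
    using comp_add_left[OF assms(1) z z] zero_add[OF z] by simp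
  then show ?thesis using add_self_zero comp_in_Hom[OF assms(1) z] by blast
qed

text \<open>Here \<open>n\<close> is the additive inverse of \<open>g\<close>, so
  \<open>add_arr A f n\<close> is the difference of \<open>f\<close> and \<open>g\<close>. The group
  structure is used once, and the cancellation arguments below need only these four facts.\<close>

lemma obtain_difference:
  assumes "f \<in> Hom A X Y" "g \<in> Hom A X Y"
  obtains n where "n \<in> Hom A X Y" "add_arr A g n = zero_arr A X Y"
    "add_arr A f n = zero_arr A X Y \<Longrightarrow> f = g" "add_arr A f n \<in> Hom A X Y"
proof -
  interpret comm_group "hom_group A X Y" using hom_comm_group HomD[OF assms(1)] by blast
  let ?G = "hom_group A X Y"
  have c: "f \<in> carrier ?G" "g \<in> carrier ?G" using assms by (auto simp: hom_group_def)
  let ?n = "inv\<^bsub>?G\<^esub> g"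
  have "?n \<in> carrier ?G" "g \<otimes>\<^bsub>?G\<^esub> ?n = \<one>\<^bsub>?G\<^esub>" "f \<otimes>\<^bsub>?G\<^esub> ?n \<in> carrier ?G"
    using c by auto
  moreover have "f \<otimes>\<^bsub>?G\<^esub> ?n = \<one>\<^bsub>?G\<^esub> \<Longrightarrow> f = g" using c right_cancel[of ?n f g] by auto
  ultimately show thesis using that[of ?n] by (simp add: hom_group_def)
qed

text \<open>Testing against zero suffices: if two arrows agree after \<open>i\<close>, then
  \<open>i\<close> kills their difference.\<close>

lemma monic_iff:
  assumes i: "i \<in> Hom A X Y"
  shows "monic A i \<longleftrightarrow>
    (\<forall>W. \<forall>t \<in> Hom A W X. i \<cdot> t = zero_arr A W Y \<longrightarrow> t = zero_arr A W X)"
proof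
  assume m: "monic A i"
  show "\<forall>W. \<forall>t \<in> Hom A W X. i \<cdot> t = zero_arr A W Y \<longrightarrow> t = zero_arr A W X"
    using monic_cancel[OF m i] comp_zero[OF i] zero_in_Hom HomD i by metis
next
  assume *: "\<forall>W. \<forall>t \<in> Hom A W X. i \<cdot> t = zero_arr A W Y \<longrightarrow> t = zero_arr A W X"
  show "monic A i"
  proof (rule monicI[OF i])
    fix W f g assume f: "f \<in> Hom A W X" and g: "g \<in> Hom A W X" and e: "i \<cdot> f = i \<cdot> g"
    obtain n where n: "n \<in> Hom A W X" "add_arr A g n = zero_arr A W X"
      "add_arr A f n = zero_arr A W X \<Longrightarrow> f = g" "add_arr A f n \<in> Hom A W X"
      using obtain_difference[OF f g] by blast
    have "i \<cdot> add_arr A f n = i \<cdot> add_arr A g n"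
      using comp_add_right[OF f n(1) i] comp_add_right[OF g n(1) i] e by simp
    also have "\<dots> = zero_arr A W Y" using n(2) comp_zero[OF i] HomD[OF f] by simp
    finally show "f = g" using * n by blast
  qed
qed

lemma epicI_zero:
  assumes p: "p \<in> Hom A X Y"
    and *: "\<And>W t. t \<in> Hom A Y W \<Longrightarrow> t \<cdot> p = zero_arr A X W \<Longrightarrow> t = zero_arr A Y W"
  shows "epic A p"
proof (rule epicI[OF p])
  fix W f g assume f: "f \<in> Hom A Y W" and g: "g \<in> Hom A Y W" and e: "f \<cdot> p = g \<cdot> p"
  obtain n where n: "n \<in> Hom A Y W" "add_arr A g n = zero_arr A Y W"
    "add_arr A f n = zero_arr A Y W \<Longrightarrow> f = g" "add_arr A f n \<in> Hom A Y W"
    using obtain_difference[OF f g] by blast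
  have "add_arr A f n \<cdot> p = add_arr A g n \<cdot> p"
    using comp_add_left[OF p f n(1)] comp_add_left[OF p g n(1)] e by simp
  also have "\<dots> = zero_arr A X W" using n(2) zero_comp[OF p] HomD[OF f] by simp
  finally show "f = g" using * n by blast
qed

text \<open>If the identity of \<open>X\<close> is zero, composing with it shows that every arrow
  into or out of \<open>X\<close> is zero. This turns a universal property into one
  equation.\<close>

lemma zero_object_iff: "zero_object A X \<longleftrightarrow> X \<in> Obj A \<and> ident A X = zero_arr A X X"
proof
  assume "zero_object A X"
  then show "X \<in> Obj A \<and> ident A X = zero_arr A X X"
    unfolding zero_object_def using ident_in_Hom zero_in_Hom by metis
next
  assume X: "X \<in> Obj A \<and> ident A X = zero_arr A X X"
  have "f = zero_arr A X Y" if "f \<in> Hom A X Y" for f Y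
    using that ident_right[OF that] comp_zero[OF that] X by simp
  moreover have "f = zero_arr A Y X" if "f \<in> Hom A Y X" for f Y
    using that ident_left[OF that] zero_comp[OF that] X by simp
  ultimately show "zero_object A X"
    unfolding zero_object_def using X zero_in_Hom by metis
qed

lemma zero_object_arrows:
  assumes "zero_object A X" "f \<in> Hom A Y X"
  shows "f = zero_arr A Y X"
  using assms ident_left[OF assms(2)] zero_comp[OF assms(2)] by (simp add: zero_object_iff)

lemma kernel_dom:
  assumes "is_kernel A k f" "f \<in> Hom A X Y"
  shows "k \<in> Hom A (Dom A k) X" "f \<cdot> k = zero_arr A (Dom A k) Y"
  using assms HomD[OF assms(2)] unfolding is_kernel_def Hom_def by auto

lemma kernel_lift:
  assumes "is_kernel A k f" "f \<in> Hom A X Y" "t \<in> Hom A W X" "f \<cdot> t = zero_arr A W Y"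
  obtains h where "h \<in> Hom A W (Dom A k)" "k \<cdot> h = t"
  using assms HomD[OF assms(2)] unfolding is_kernel_def by metis

lemma kernel_monic:
  assumes k: "is_kernel A k f"
  shows "monic A k"
proof (rule monicI)
  let ?X = "Dom A f" and ?Y = "Cod A f"
  have f: "f \<in> Hom A ?X ?Y" using k by (simp add: is_kernel_def Arr_in_Hom)
  show kh: "k \<in> Hom A (Dom A k) ?X" using kernel_dom[OF k f] by blast
  fix W a b assume a: "a \<in> Hom A W (Dom A k)" and b: "b \<in> Hom A W (Dom A k)" and e: "k \<cdot> a = k \<cdot> b"
  have t: "k \<cdot> a \<in> Hom A W ?X" using a kh comp_in_Hom by blast
  have "f \<cdot> (k \<cdot> a) = zero_arr A W ?Y"
    using comp_assoc[OF a kh f] kernel_dom(2)[OF k f] zero_comp[OF a] HomD[OF f] by simp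
  then have "\<exists>!h. h \<in> Hom A W (Dom A k) \<and> k \<cdot> h = k \<cdot> a"
    using k t unfolding is_kernel_def by blast
  then show "a = b" using a b e by metis
qed

lemma cokernel_cod:
  assumes "is_cokernel A c f" "f \<in> Hom A X Y"
  shows "c \<in> Hom A Y (Cod A c)" "c \<cdot> f = zero_arr A X (Cod A c)"
  using assms HomD[OF assms(2)] unfolding is_cokernel_def Hom_def by auto

lemma cokernel_factor:
  assumes "is_cokernel A c f" "f \<in> Hom A X Y" "t \<in> Hom A Y W" "t \<cdot> f = zero_arr A X W"
  obtains h where "h \<in> Hom A (Cod A c) W" "h \<cdot> c = t"
  using assms HomD[OF assms(2)] unfolding is_cokernel_def by metis

lemma cokernel_epic:
  assumes c: "is_cokernel A c f"
  shows "epic A c"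
proof (rule epicI)
  let ?X = "Dom A f" and ?Y = "Cod A f"
  have f: "f \<in> Hom A ?X ?Y" using c by (simp add: is_cokernel_def Arr_in_Hom)
  show ch: "c \<in> Hom A ?Y (Cod A c)" using cokernel_cod[OF c f] by blast
  fix W a b assume a: "a \<in> Hom A (Cod A c) W" and b: "b \<in> Hom A (Cod A c) W" and e: "a \<cdot> c = b \<cdot> c"
  have t: "a \<cdot> c \<in> Hom A ?Y W" using a ch comp_in_Hom by blast
  have "(a \<cdot> c) \<cdot> f = zero_arr A ?X W"
    using comp_assoc[OF f ch a] cokernel_cod(2)[OF c f] comp_zero[OF a] HomD[OF f] by simp
  then have "\<exists>!h. h \<in> Hom A (Cod A c) W \<and> h \<cdot> c = a \<cdot> c"
    using c t unfolding is_cokernel_def by blast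
  then show "a = b" using a b e by metis
qed

text \<open>An arrow killed by \<open>f\<close> lifts through the kernel, hence through a zero
  object, and is therefore zero.\<close>

lemma monic_of_zero_kernel:
  assumes k: "is_kernel A k f" and z: "zero_object A (Dom A k)"
  shows "monic A f"
proof -
  let ?X = "Dom A f" and ?Y = "Cod A f"
  have f: "f \<in> Hom A ?X ?Y" using k by (simp add: is_kernel_def Arr_in_Hom)
  have "t = zero_arr A W ?X" if t: "t \<in> Hom A W ?X" "f \<cdot> t = zero_arr A W ?Y" for W t
  proof -
    obtain h where h: "h \<in> Hom A W (Dom A k)" "k \<cdot> h = t" using kernel_lift[OF k f t] by blast
    then show ?thesis
      using zero_object_arrows[OF z h(1)] comp_zero[OF kernel_dom(1)[OF k f]] HomD[OF h(1)] by metis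
  qed
  then show ?thesis using monic_iff[OF f] by blast
qed

text \<open>Since \<open>f\<close> is monic, \<open>i\<close> is zero; then \<open>i\<close> kills
  the identity of \<open>X\<close>, and since \<open>i\<close> is monic that identity is
  zero.\<close>

lemma monic_annihilated_zero:
  assumes "monic A i" "i \<in> Hom A X Y" "f \<in> Hom A Y Z" "f \<cdot> i = zero_arr A X Z" "monic A f"
  shows "zero_object A X"
proof -
  have X: "X \<in> Obj A" using HomD[OF assms(2)] by blast
  have "i = zero_arr A X Y" using assms monic_iff by blast
  then have "i \<cdot> ident A X = zero_arr A X Y" using ident_right[OF assms(2)] by simp
  then have "ident A X = zero_arr A X X" using monic_iff[OF assms(2)] assms(1) ident_in_Hom[OF X] by blast
  then show ?thesis using X zero_object_iff by blast
qed

end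

section \<open>Normal monos and epis, images, quotients and intersections\<close>

context abelian_category
begin

text \<open>By normality \<open>i\<close> is a kernel of some \<open>f\<close>, and \<open>f\<close>
  factors through \<open>c\<close>. Whatever \<open>c\<close> kills is killed by \<open>f\<close>
  too, so it lifts uniquely through \<open>i\<close>.\<close>

lemma monic_kernel_of_cokernel:
  assumes m: "monic A i" and c: "is_cokernel A c i"
  shows "is_kernel A i c"
proof -
  let ?X = "Dom A i" and ?Y = "Cod A i"
  have i: "i \<in> Hom A ?X ?Y" using m by (simp add: monic_def Arr_in_Hom)
  have ch: "c \<in> Hom A ?Y (Cod A c)" "c \<cdot> i = zero_arr A ?X (Cod A c)" using cokernel_cod[OF c i] by blast+
  obtain f where f: "is_kernel A i f" using monic_is_kernel[OF m] by blast
  have fh: "f \<in> Hom A ?Y (Cod A f)" using f by (simp add: is_kernel_def Hom_def)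
  obtain g where g: "g \<in> Hom A (Cod A c) (Cod A f)" "g \<cdot> c = f"
    using cokernel_factor[OF c i fh] kernel_dom(2)[OF f fh] by blast
  have "\<exists>!h. h \<in> Hom A W ?X \<and> i \<cdot> h = t"
    if t: "t \<in> Hom A W ?Y" "c \<cdot> t = zero_arr A W (Cod A c)" for W t
  proof -
    have "f \<cdot> t = zero_arr A W (Cod A f)"
      using comp_assoc[OF t(1) ch(1) g(1)] g(2) t(2) comp_zero[OF g(1)] HomD[OF t(1)] by simp
    moreover have "t \<in> Hom A W (Dom A f)" using t(1) HomD[OF fh] by simp
    ultimately show ?thesis using f unfolding is_kernel_def by blast
  qed
  then show ?thesis unfolding is_kernel_def using i ch HomD[OF ch(1)] HomD[OF i] by auto
qed

text \<open>Dual argument: \<open>p\<close> is a cokernel of some \<open>f\<close>, and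
  \<open>f\<close> factors through \<open>k\<close>, so an arrow killing \<open>k\<close> also kills
  \<open>f\<close>.\<close>

lemma epic_factor:
  assumes p: "epic A p" "p \<in> Hom A X Y" and k: "is_kernel A k p"
    and t: "t \<in> Hom A X W" "t \<cdot> k = zero_arr A (Dom A k) W"
  obtains h where "h \<in> Hom A Y W" "h \<cdot> p = t"
proof -
  obtain f where f: "is_cokernel A p f" using epic_is_cokernel[OF p(1)] by blast
  have fh: "f \<in> Hom A (Dom A f) X" using f HomD[OF p(2)] unfolding is_cokernel_def Hom_def by auto
  have kh: "k \<in> Hom A (Dom A k) X" using kernel_dom[OF k p(2)] by blast
  obtain g where g: "g \<in> Hom A (Dom A f) (Dom A k)" "k \<cdot> g = f"
    using kernel_lift[OF k p(2) fh] cokernel_cod(2)[OF f fh] HomD[OF p(2)] by metis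
  have "t \<cdot> f = zero_arr A (Dom A f) W"
    using comp_assoc[OF g(1) kh t(1)] g(2) t(2) zero_comp[OF g(1)] HomD[OF t(1)] by simp
  then show thesis using cokernel_factor[OF f fh t(1)] that HomD[OF p(2)] by metis
qed

text \<open>The image is the kernel of the cokernel of \<open>f\<close>. If \<open>t\<close> kills
  \<open>e\<close> and \<open>k\<close> is a kernel of \<open>t\<close>, then \<open>f\<close>
  already factors through \<open>m \<cdot> k\<close>; minimality of the image gives \<open>k\<close>
  a right inverse, so \<open>t\<close> is zero.\<close>

lemma image_factorization:
  assumes f: "f \<in> Hom A X Y"
  obtains I m e where "m \<in> Hom A I Y" "monic A m" "e \<in> Hom A X I" "epic A e" "m \<cdot> e = f"
proof -
  obtain c where c: "is_cokernel A c f" using cokernel_exists HomD[OF f] by blast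
  have ch: "c \<in> Hom A Y (Cod A c)" "c \<cdot> f = zero_arr A X (Cod A c)" using cokernel_cod[OF c f] by blast+
  obtain m where mk: "is_kernel A m c" using kernel_exists HomD[OF ch(1)] by blast
  let ?I = "Dom A m"
  have m: "m \<in> Hom A ?I Y" "c \<cdot> m = zero_arr A ?I (Cod A c)" using kernel_dom[OF mk ch(1)] by blast+
  have mm: "monic A m" using kernel_monic[OF mk] .
  obtain e where e: "e \<in> Hom A X ?I" "m \<cdot> e = f" using kernel_lift[OF mk ch(1) f ch(2)] by blast
  have "t = zero_arr A ?I W" if t: "t \<in> Hom A ?I W" "t \<cdot> e = zero_arr A X W" for W t
  proof -
    obtain k where k: "is_kernel A k t" using kernel_exists HomD[OF t(1)] by blast
    let ?K = "Dom A k"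
    have kh: "k \<in> Hom A ?K ?I" "t \<cdot> k = zero_arr A ?K W" using kernel_dom[OF k t(1)] by blast+
    obtain e' where e': "e' \<in> Hom A X ?K" "k \<cdot> e' = e" using kernel_lift[OF k t(1) e(1) t(2)] by blast
    have mkh: "m \<cdot> k \<in> Hom A ?K Y" using comp_in_Hom[OF kh(1) m(1)] .
    have "monic A (m \<cdot> k)" using monic_comp[OF kernel_monic[OF k] mm kh(1) m(1)] .
    \<comment> \<open>Minimality of the image: \<open>m \<cdot> k\<close> is a kernel of some
      \<open>g\<close>, which kills \<open>f\<close>, hence factors through \<open>c\<close>, hence
      kills \<open>m\<close>. So \<open>m\<close> lifts through \<open>m \<cdot> k\<close>.\<close>
    then obtain g where g: "is_kernel A (m \<cdot> k) g" using monic_is_kernel by blast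
    have gh: "g \<in> Hom A Y (Cod A g)" using g HomD[OF mkh] unfolding is_kernel_def Hom_def by auto
    have dk: "Dom A (m \<cdot> k) = ?K" using HomD[OF mkh] by blast
    have "g \<cdot> f = g \<cdot> ((m \<cdot> k) \<cdot> e')" using comp_assoc[OF e'(1) kh(1) m(1)] e' e by simp
    also have "\<dots> = zero_arr A X (Cod A g)"
      using comp_assoc[OF e'(1) mkh gh] kernel_dom(2)[OF g gh] dk zero_comp[OF e'(1)] HomD[OF gh] by simp
    finally obtain g' where g': "g' \<in> Hom A (Cod A c) (Cod A g)" "g' \<cdot> c = g"
      using cokernel_factor[OF c f gh] by blast
    have "g \<cdot> m = zero_arr A ?I (Cod A g)"
      using comp_assoc[OF m(1) ch(1) g'(1)] g'(2) m(2) comp_zero[OF g'(1)] HomD[OF m(1)] by simp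
    then obtain s where s: "s \<in> Hom A ?I ?K" "(m \<cdot> k) \<cdot> s = m"
      using kernel_lift[OF g gh m(1)] dk by metis
    have ks: "k \<cdot> s \<in> Hom A ?I ?I" using comp_in_Hom[OF s(1) kh(1)] .
    have I: "?I \<in> Obj A" using HomD[OF m(1)] by blast
    have "m \<cdot> (k \<cdot> s) = m \<cdot> ident A ?I"
      using comp_assoc[OF s(1) kh(1) m(1)] s(2) ident_right[OF m(1)] by simp
    then have "k \<cdot> s = ident A ?I" using monic_cancel[OF mm m(1) ks ident_in_Hom[OF I]] by blast
    then have "t = (t \<cdot> k) \<cdot> s" using comp_assoc[OF s(1) kh(1) t(1)] ident_right[OF t(1)] by simp
    then show ?thesis using kh(2) zero_comp[OF s(1)] HomD[OF t(1)] by simp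
  qed
  then have "epic A e" using epicI_zero[OF e(1)] by blast
  then show thesis using that m(1) mm e by blast
qed

text \<open>For \<open>K \<subseteq> N \<subseteq> M\<close>, the canonical map \<open>N/K \<rightarrow> M/K\<close> is a monomorphism.\<close>

lemma quotient_of_subobject:
  assumes k: "monic A k" "k \<in> Hom A K N" and i: "monic A i" "i \<in> Hom A N M"
    and p: "is_cokernel A p k" and c: "is_cokernel A c (i \<cdot> k)"
  shows "\<exists>j \<in> Hom A (Cod A p) (Cod A c). monic A j"
proof -
  have ik: "i \<cdot> k \<in> Hom A K M" using comp_in_Hom[OF k(2) i(2)] .
  let ?Q = "Cod A p" and ?C = "Cod A c"
  have ph: "p \<in> Hom A N ?Q" "p \<cdot> k = zero_arr A K ?Q" using cokernel_cod[OF p k(2)] by blast+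
  have ch: "c \<in> Hom A M ?C" "c \<cdot> (i \<cdot> k) = zero_arr A K ?C" using cokernel_cod[OF c ik] by blast+
  have ci: "c \<cdot> i \<in> Hom A N ?C" using comp_in_Hom[OF i(2) ch(1)] .
  have "(c \<cdot> i) \<cdot> k = zero_arr A K ?C" using comp_assoc[OF k(2) i(2) ch(1)] ch(2) by simp
  then obtain j where j: "j \<in> Hom A ?Q ?C" "j \<cdot> p = c \<cdot> i" using cokernel_factor[OF p k(2) ci] by blast
  \<comment> \<open>Arrows into \<open>?Q\<close> need not lift along \<open>p\<close>, so
    \<open>j\<close> is not tested on them directly. Instead the epic part \<open>e\<close> of
    \<open>j\<close> is shown to be split monic, by factoring \<open>p\<close> through
    \<open>e \<cdot> p\<close>.\<close>
  obtain I m e where me: "m \<in> Hom A I ?C" "monic A m" "e \<in> Hom A ?Q I" "epic A e" "m \<cdot> e = j"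
    using image_factorization[OF j(1)] by blast
  have ep: "e \<cdot> p \<in> Hom A N I" "epic A (e \<cdot> p)"
    using comp_in_Hom[OF ph(1) me(3)] epic_comp[OF cokernel_epic[OF p] me(4) ph(1) me(3)] by blast+
  obtain k' where k': "is_kernel A k' (e \<cdot> p)" using kernel_exists HomD[OF ep(1)] by blast
  let ?K' = "Dom A k'"
  have k'h: "k' \<in> Hom A ?K' N" "(e \<cdot> p) \<cdot> k' = zero_arr A ?K' I" using kernel_dom[OF k' ep(1)] by blast+
  have ik': "i \<cdot> k' \<in> Hom A ?K' M" using comp_in_Hom[OF k'h(1) i(2)] .
  have "c \<cdot> (i \<cdot> k') = (j \<cdot> p) \<cdot> k'" using comp_assoc[OF k'h(1) i(2) ch(1)] j(2) by simp
  also have "\<dots> = (m \<cdot> (e \<cdot> p)) \<cdot> k'" using comp_assoc[OF ph(1) me(3) me(1)] me(5) by simp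
  also have "\<dots> = zero_arr A ?K' ?C"
    using comp_assoc[OF k'h(1) ep(1) me(1)] k'h(2) comp_zero[OF me(1)] HomD[OF k'h(1)] by simp
  finally have cz: "c \<cdot> (i \<cdot> k') = zero_arr A ?K' ?C" .
  \<comment> \<open>As \<open>i \<cdot> k\<close> is a kernel of \<open>c\<close>, the vanishing of
    \<open>c\<close> on \<open>i \<cdot> k'\<close> puts the kernel of \<open>e \<cdot> p\<close>
    inside \<open>K\<close>, where \<open>p\<close> vanishes.\<close>
  have "is_kernel A (i \<cdot> k) c"
    using monic_kernel_of_cokernel[OF monic_comp[OF k(1) i(1) k(2) i(2)] c] .
  then obtain s where s: "s \<in> Hom A ?K' K" "(i \<cdot> k) \<cdot> s = i \<cdot> k'"
    using kernel_lift[OF _ ch(1) ik' cz] HomD[OF ik] by metis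
  have ks: "k \<cdot> s \<in> Hom A ?K' N" using comp_in_Hom[OF s(1) k(2)] .
  have "k \<cdot> s = k'"
    using monic_cancel[OF i(1,2) ks k'h(1)] comp_assoc[OF s(1) k(2) i(2)] s(2) by simp
  then have "p \<cdot> k' = zero_arr A ?K' ?Q"
    using comp_assoc[OF s(1) k(2) ph(1)] ph(2) zero_comp[OF s(1)] HomD[OF ph(1)] by auto
  then obtain h where h: "h \<in> Hom A I ?Q" "h \<cdot> (e \<cdot> p) = p"
    using epic_factor[OF ep(2,1) k' ph(1)] by blast
  have he: "h \<cdot> e \<in> Hom A ?Q ?Q" using comp_in_Hom[OF me(3) h(1)] .
  have Q: "?Q \<in> Obj A" using HomD[OF ph(1)] by blast
  have "(h \<cdot> e) \<cdot> p = ident A ?Q \<cdot> p" using comp_assoc[OF ph(1) me(3) h(1)] h(2) ident_left[OF ph(1)] by simp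
  then have "h \<cdot> e = ident A ?Q"
    using epic_cancel[OF cokernel_epic[OF p] ph(1) he ident_in_Hom[OF Q]] by blast
  then have "monic A e" using split_monic[OF me(3) h(1)] by blast
  then have "monic A j" using monic_comp[OF _ me(2) me(3) me(1)] me(5) by blast
  then show ?thesis using j(1) by blast
qed

text \<open>The kernel of \<open>N \<rightarrow> M \<rightarrow> M/L\<close> is the intersection of \<open>L\<close> and \<open>N\<close>.\<close>

lemma intersection_or_monic:
  assumes l: "monic A l" "l \<in> Hom A L M" and n: "monic A n" "n \<in> Hom A N M"
    and c: "is_cokernel A c l"
  shows "monic A (c \<cdot> n) \<or> (\<exists>I. \<not> zero_object A I \<and> subobject A I L \<and> subobject A I N)"
proof -
  have ch: "c \<in> Hom A M (Cod A c)" using cokernel_cod[OF c l(2)] by blast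
  have cn: "c \<cdot> n \<in> Hom A N (Cod A c)" using comp_in_Hom[OF n(2) ch] .
  obtain k where k: "is_kernel A k (c \<cdot> n)" using kernel_exists HomD[OF cn] by blast
  let ?I = "Dom A k"
  have kh: "k \<in> Hom A ?I N" "(c \<cdot> n) \<cdot> k = zero_arr A ?I (Cod A c)" using kernel_dom[OF k cn] by blast+
  have km: "monic A k" using kernel_monic[OF k] .
  have nk: "n \<cdot> k \<in> Hom A ?I M" using comp_in_Hom[OF kh(1) n(2)] .
  have "c \<cdot> (n \<cdot> k) = zero_arr A ?I (Cod A c)" using comp_assoc[OF kh(1) n(2) ch] kh(2) by simp
  then obtain h where h: "h \<in> Hom A ?I L" "l \<cdot> h = n \<cdot> k"
    using kernel_lift[OF monic_kernel_of_cokernel[OF l(1) c] ch nk] HomD[OF l(2)] by metis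
  have "monic A h"
  proof (rule monicI[OF h(1)])
    fix W f g assume f: "f \<in> Hom A W ?I" and g: "g \<in> Hom A W ?I" and "h \<cdot> f = h \<cdot> g"
    then have "(n \<cdot> k) \<cdot> f = (n \<cdot> k) \<cdot> g" using comp_assoc[OF _ h(1) l(2)] h(2) by metis
    then show "f = g" using monic_cancel[OF monic_comp[OF km n(1) kh(1) n(2)] nk f g] by blast
  qed
  then have "subobject A ?I L" "subobject A ?I N" unfolding subobject_def using h kh km by blast+
  then show ?thesis using monic_of_zero_kernel[OF k] by blast
qed

section \<open>Subobjects and monoform objects\<close>

lemma subobject_trans: "subobject A X Y \<Longrightarrow> subobject A Y Z \<Longrightarrow> subobject A X Z"
  unfolding subobject_def by (meson comp_in_Hom monic_comp)

lemma quotient_object_trans: "quotient_object A X Y \<Longrightarrow> quotient_object A Y Z \<Longrightarrow> quotient_object A X Z"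
  unfolding quotient_object_def by (meson comp_in_Hom epic_comp)

lemma subobject_refl: "X \<in> Obj A \<Longrightarrow> subobject A X X"
  unfolding subobject_def using ident_in_Hom monic_ident by blast

lemma quotient_object_refl: "X \<in> Obj A \<Longrightarrow> quotient_object A X X"
  unfolding quotient_object_def using ident_in_Hom epic_ident by blast

lemma subquotient_refl: "X \<in> Obj A \<Longrightarrow> subquotient A X X"
  unfolding subquotient_def using subobject_refl quotient_object_refl by blast

lemma subobject_subquotient: "subobject A X Y \<Longrightarrow> subquotient A X Y"
  unfolding subquotient_def using quotient_object_refl subobject_def HomD by metis

lemma cokernel_quotient_object:
  assumes "is_cokernel A c f" "f \<in> Hom A X Y"
  shows "quotient_object A (Cod A c) Y"
  unfolding quotient_object_def using cokernel_cod[OF assms] cokernel_epic[OF assms(1)] by blast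

text \<open>With \<open>K\<close> the kernel of \<open>N \<rightarrow> Q\<close>, the object
  \<open>C\<close> is \<open>M/K\<close>, which contains \<open>N/K\<close>. Thus quotients of
  subobjects are subquotients in the chosen sense.\<close>

lemma quotient_of_subobject_is_subobject:
  assumes Q: "quotient_object A Q N" and N: "subobject A N M"
  shows "\<exists>C. quotient_object A C M \<and> subobject A Q C"
proof -
  obtain p where p: "p \<in> Hom A N Q" "epic A p" using Q unfolding quotient_object_def by blast
  obtain i where i: "i \<in> Hom A N M" "monic A i" using N unfolding subobject_def by blast
  obtain k where k: "is_kernel A k p" using kernel_exists HomD[OF p(1)] by blast
  have kh: "k \<in> Hom A (Dom A k) N" using kernel_dom[OF k p(1)] by blast
  have km: "monic A k" using kernel_monic[OF k] .
  have ik: "i \<cdot> k \<in> Hom A (Dom A k) M" using comp_in_Hom[OF kh i(1)] .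
  \<comment> \<open>An epic arrow is a cokernel of its kernel.\<close>
  have "is_cokernel A p k"
  proof -
    have "\<exists>!h. h \<in> Hom A (Cod A p) W \<and> h \<cdot> p = t"
      if t: "t \<in> Hom A (Cod A k) W" "t \<cdot> k = zero_arr A (Dom A k) W" for W t
    proof -
      have tN: "t \<in> Hom A N W" using t HomD[OF kh] by simp
      obtain h where "h \<in> Hom A Q W" "h \<cdot> p = t" using epic_factor[OF p(2,1) k tN t(2)] by blast
      then show ?thesis using epic_cancel[OF p(2,1)] HomD[OF p(1)] by metis
    qed
    then show ?thesis unfolding is_cokernel_def using HomD[OF p(1)] HomD[OF kh] kernel_dom(2)[OF k p(1)] by simp
  qed
  moreover obtain c where c: "is_cokernel A c (i \<cdot> k)" using cokernel_exists HomD[OF ik] by blast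
  ultimately obtain j where "j \<in> Hom A Q (Cod A c)" "monic A j"
    using quotient_of_subobject[OF km kh i(2,1) _ c] HomD[OF p(1)] by metis
  then show ?thesis using cokernel_quotient_object[OF c ik] unfolding subobject_def by blast
qed

text \<open>A violation in \<open>N\<close> is one in \<open>H\<close>: for a subobject
  \<open>N'\<close> of \<open>N\<close>, the quotient \<open>N/N'\<close> embeds into
  \<open>H/N'\<close>.\<close>

lemma monoform_subobject:
  assumes H: "monoform A H" and N: "subobject A N H" "\<not> zero_object A N"
  shows "monoform A N"
  unfolding monoform_def
proof (intro conjI allI impI notI)
  obtain j where j: "j \<in> Hom A N H" "monic A j" using N unfolding subobject_def by blast
  show "N \<in> Obj A" using HomD[OF j(1)] by blast
  show False if "zero_object A N" using that N by blast
  fix i c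
  assume ic: "monic A i \<and> Cod A i = N \<and> \<not> zero_object A (Dom A i) \<and> is_cokernel A c i"
    and "\<exists>L. \<not> zero_object A L \<and> subobject A L N \<and> subobject A L (Cod A c)"
  then obtain L where L: "\<not> zero_object A L" "subobject A L N" "subobject A L (Cod A c)" by blast
  have i: "i \<in> Hom A (Dom A i) N" using ic unfolding monic_def Hom_def by blast
  have ji: "j \<cdot> i \<in> Hom A (Dom A i) H" using comp_in_Hom[OF i j(1)] .
  obtain d where d: "is_cokernel A d (j \<cdot> i)" using cokernel_exists HomD[OF ji] by blast
  have "subobject A (Cod A c) (Cod A d)"
    unfolding subobject_def using quotient_of_subobject[OF _ i j(2,1) _ d] ic by blast
  then have "subobject A L (Cod A d)" "subobject A L H" using L N subobject_trans by blast+
  moreover have "monic A (j \<cdot> i)" using monic_comp[OF _ j(2) i j(1)] ic by blast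
  moreover have "Cod A (j \<cdot> i) = H" "Dom A (j \<cdot> i) = Dom A i" using HomD[OF ji] by blast+
  ultimately show False using H d L(1) ic unfolding monoform_def by metis
qed

text \<open>If \<open>L\<close> and \<open>N\<close> met only in zero, \<open>N\<close> would embed
  into \<open>H/L\<close>, and \<open>N\<close> itself would be a forbidden common subobject of
  \<open>H\<close> and \<open>H/L\<close>.\<close>

lemma monoform_uniform:
  assumes H: "monoform A H" and L: "subobject A L H" "\<not> zero_object A L"
    and N: "subobject A N H" "\<not> zero_object A N"
  shows "\<exists>I. \<not> zero_object A I \<and> subobject A I L \<and> subobject A I N"
proof -
  obtain l where l: "l \<in> Hom A L H" "monic A l" using L unfolding subobject_def by blast
  obtain n where n: "n \<in> Hom A N H" "monic A n" using N unfolding subobject_def by blast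
  obtain c where c: "is_cokernel A c l" using cokernel_exists HomD[OF l(1)] by blast
  have "c \<cdot> n \<in> Hom A N (Cod A c)" using comp_in_Hom[OF n(1)] cokernel_cod[OF c l(1)] by blast
  moreover have "\<not> subobject A N (Cod A c)"
    using H c l L(2) N HomD[OF l(1)] unfolding monoform_def by metis
  ultimately have "\<not> monic A (c \<cdot> n)" unfolding subobject_def by blast
  then show ?thesis using intersection_or_monic[OF l(2,1) n(2,1) c] by blast
qed

lemma equiv_atom_equiv: "equiv {H. monoform A H} (atom_equiv A)"
proof (rule equivI)
  show "atom_equiv A \<subseteq> {H. monoform A H} \<times> {H. monoform A H}" unfolding atom_equiv_def by blast
  show "refl_on {H. monoform A H} (atom_equiv A)"
  proof (rule refl_onI)
    fix H assume "H \<in> {H. monoform A H}"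
    then have "monoform A H" "\<not> zero_object A H" "subobject A H H"
      using subobject_refl by (auto simp: monoform_def)
    then show "(H, H) \<in> atom_equiv A" unfolding atom_equiv_def by blast
  qed
  show "sym (atom_equiv A)" unfolding sym_def atom_equiv_def by blast
  show "trans (atom_equiv A)"
  proof (rule transI)
    fix X Y Z assume "(X, Y) \<in> atom_equiv A" "(Y, Z) \<in> atom_equiv A"
    then obtain L N where "monoform A X" "monoform A Y" "monoform A Z"
      "\<not> zero_object A L" "subobject A L X" "subobject A L Y"
      "\<not> zero_object A N" "subobject A N Y" "subobject A N Z" unfolding atom_equiv_def by blast
    \<comment> \<open>Both witnesses lie in the middle object \<open>Y\<close>, so uniformity of
      \<open>Y\<close> gives them a common nonzero subobject.\<close>
    moreover from this obtain I where "\<not> zero_object A I" "subobject A I L" "subobject A I N"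
      using monoform_uniform by blast
    moreover from calculation have "subobject A I X" "subobject A I Z" using subobject_trans by blast+
    ultimately show "(X, Z) \<in> atom_equiv A" unfolding atom_equiv_def by blast
  qed
qed

lemma atom_monoform: "\<alpha> \<in> ASpec A \<Longrightarrow> H \<in> \<alpha> \<Longrightarrow> monoform A H"
  by (auto simp: ASpec_def quotient_def atom_equiv_def)

text \<open>\<open>L\<close> is a common nonzero subobject of \<open>H\<close> and of itself. A
  representative of an atom may thus be shrunk at will.\<close>

lemma atom_subobject:
  assumes \<alpha>: "\<alpha> \<in> ASpec A" "H \<in> \<alpha>" and L: "subobject A L H" "\<not> zero_object A L"
  shows "L \<in> \<alpha>"
proof -
  have H: "monoform A H" using atom_monoform[OF \<alpha>] .
  have M: "monoform A L" using monoform_subobject[OF H L] .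
  then have "subobject A L L" using subobject_refl by (simp add: monoform_def)
  then have "(H, L) \<in> atom_equiv A" unfolding atom_equiv_def using H M L by blast
  then show ?thesis
    using in_quotient_imp_closed[OF equiv_atom_equiv _ \<alpha>(2)] \<alpha>(1) unfolding ASpec_def by blast
qed

section \<open>Atom supports and Serre subcategories\<close>

lemma ASupp_quotient: "quotient_object A N M \<Longrightarrow> ASupp A N \<subseteq> ASupp A M"
  unfolding ASupp_def subquotient_def using quotient_object_trans by blast

lemma ASupp_subobject:
  assumes "subobject A N M"
  shows "ASupp A N \<subseteq> ASupp A M"
  unfolding ASupp_def subquotient_def
  using quotient_of_subobject_is_subobject[OF _ assms] subobject_trans by blast

text \<open>A representative \<open>H\<close> sits inside a quotient \<open>Q\<close> of the middle
  term. The outer terms are therefore replaced by the image \<open>I\<close> of the left term in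
  \<open>Q\<close> and by \<open>Q/I\<close>, which are quotients of them.\<close>

lemma ASupp_extension:
  assumes fg: "short_exact A f g"
  shows "ASupp A (Cod A f) \<subseteq> ASupp A (Dom A f) \<union> ASupp A (Cod A g)"
proof
  let ?L = "Dom A f" and ?M = "Cod A f" and ?N = "Cod A g"
  have gc: "is_cokernel A g f" using fg unfolding short_exact_def by blast
  have f: "f \<in> Hom A ?L ?M" using gc unfolding is_cokernel_def Hom_def by blast
  have g: "g \<in> Hom A ?M ?N" using cokernel_cod[OF gc f] by blast
  fix \<alpha> assume "\<alpha> \<in> ASupp A ?M"
  then obtain H Q p h where a: "\<alpha> \<in> ASpec A" "H \<in> \<alpha>" and p: "p \<in> Hom A ?M Q" "epic A p"
    and h: "h \<in> Hom A H Q" "monic A h"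
    unfolding ASupp_def subquotient_def quotient_object_def subobject_def by blast
  have pf: "p \<cdot> f \<in> Hom A ?L Q" using comp_in_Hom[OF f p(1)] .
  obtain I m e where me: "m \<in> Hom A I Q" "monic A m" "e \<in> Hom A ?L I" "epic A e" "m \<cdot> e = p \<cdot> f"
    using image_factorization[OF pf] by blast
  obtain c where c: "is_cokernel A c m" using cokernel_exists HomD[OF me(1)] by blast
  let ?C = "Cod A c"
  have ch: "c \<in> Hom A Q ?C" "c \<cdot> m = zero_arr A I ?C" using cokernel_cod[OF c me(1)] by blast+
  have cp: "c \<cdot> p \<in> Hom A ?M ?C" using comp_in_Hom[OF p(1) ch(1)] .
  have "(c \<cdot> p) \<cdot> f = (c \<cdot> m) \<cdot> e"
    using comp_assoc[OF f p(1) ch(1)] comp_assoc[OF me(3) me(1) ch(1)] me(5) by simp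
  then have "(c \<cdot> p) \<cdot> f = zero_arr A ?L ?C" using ch(2) zero_comp[OF me(3)] HomD[OF ch(1)] by simp
  \<comment> \<open>The composite onto \<open>Q/I\<close> kills the left term, so it factors through
    \<open>g\<close>; the factor \<open>q\<close> is epic because the composite is.\<close>
  then obtain q where q: "q \<in> Hom A ?N ?C" "q \<cdot> g = c \<cdot> p" using cokernel_factor[OF gc f cp] by blast
  have "epic A (c \<cdot> p)" using epic_comp[OF p(2) cokernel_epic[OF c] p(1) ch(1)] .
  then have "epic A q" using epic_of_comp[OF _ g q(1)] q(2) by simp
  then have CN: "quotient_object A ?C ?N" unfolding quotient_object_def using q(1) by blast
  have IL: "quotient_object A I ?L" unfolding quotient_object_def using me by blast
  consider "monic A (c \<cdot> h)" | J where "\<not> zero_object A J" "subobject A J I" "subobject A J H"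
    using intersection_or_monic[OF me(2,1) h(2,1) c] by blast
  then show "\<alpha> \<in> ASupp A ?L \<union> ASupp A ?N"
  proof cases
    case 1
    then have "subobject A H ?C" unfolding subobject_def using comp_in_Hom[OF h(1) ch(1)] by blast
    then show ?thesis using a CN unfolding ASupp_def subquotient_def by blast
  next
    case 2
    then have "J \<in> \<alpha>" using atom_subobject a by blast
    then show ?thesis using 2 a IL unfolding ASupp_def subquotient_def by blast
  qed
qed

lemma zero_object_quotient:
  assumes Z: "zero_object A Z" and Q: "quotient_object A Q Z"
  shows "zero_object A Q"
proof -
  obtain p where p: "p \<in> Hom A Z Q" "epic A p" using Q unfolding quotient_object_def by blast
  have Zid: "ident A Z = zero_arr A Z Z" and ZO: "Z \<in> Obj A" using Z zero_object_iff by blast+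
  have QO: "Q \<in> Obj A" using HomD[OF p(1)] by blast
  have "p = zero_arr A Z Q" using ident_right[OF p(1)] comp_zero[OF p(1) ZO] Zid by simp
  then have "ident A Q \<cdot> p = zero_arr A Q Q \<cdot> p"
    using ident_left[OF p(1)] zero_comp[OF p(1) QO] by simp
  then have "ident A Q = zero_arr A Q Q"
    using epic_cancel[OF p(2,1) ident_in_Hom[OF QO] zero_in_Hom[OF QO QO]] by blast
  then show ?thesis using QO zero_object_iff by blast
qed

lemma zero_object_subobject:
  assumes Z: "zero_object A Z" and L: "subobject A L Z"
  shows "zero_object A L"
proof -
  obtain i where i: "i \<in> Hom A L Z" "monic A i" using L unfolding subobject_def by blast
  have ZO: "Z \<in> Obj A" using Z zero_object_iff by blast
  \<comment> \<open>The identity of \<open>Z\<close> serves as the monic arrow that annihilates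
    \<open>i\<close>.\<close>
  have "ident A Z \<cdot> i = zero_arr A L Z" using zero_object_arrows[OF Z i(1)] ident_left[OF i(1)] by simp
  then show ?thesis
    using monic_annihilated_zero[OF i(2,1) ident_in_Hom[OF ZO] _ monic_ident[OF ZO]] by blast
qed

lemma ASupp_zero:
  assumes "zero_object A Z"
  shows "ASupp A Z = {}"
proof -
  have "zero_object A H" if "subquotient A H Z" for H
    using that assms zero_object_quotient zero_object_subobject unfolding subquotient_def by blast
  moreover have "\<not> zero_object A H" if "\<alpha> \<in> ASpec A" "H \<in> \<alpha>" for \<alpha> H
    using atom_monoform[OF that] by (simp add: monoform_def)
  ultimately show ?thesis unfolding ASupp_def by blast
qed

text \<open>Reduces closure under isomorphism to closure under subobjects.\<close>

lemma isomorphic_subobject: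
  assumes "isomorphic A M N"
  shows "subobject A N M"
  using assms split_monic unfolding isomorphic_def subobject_def by blast

lemma serre_of_atoms: "serre_subcategory A {M \<in> Obj A. ASupp A M \<subseteq> \<Phi>}"
proof -
  have sub: "N \<in> Obj A \<and> ASupp A N \<subseteq> \<Phi>" if "ASupp A M \<subseteq> \<Phi>" "subobject A N M" for M N
    using that(1) ASupp_subobject[OF that(2)] HomD that(2)[unfolded subobject_def] by blast
  have quot: "N \<in> Obj A \<and> ASupp A N \<subseteq> \<Phi>" if "ASupp A M \<subseteq> \<Phi>" "quotient_object A N M" for M N
    using that(1) ASupp_quotient[OF that(2)] HomD that(2)[unfolded quotient_object_def] by blast
  have ext: "Cod A f \<in> Obj A \<and> ASupp A (Cod A f) \<subseteq> \<Phi>"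
    if "short_exact A f g" "ASupp A (Dom A f) \<subseteq> \<Phi>" "ASupp A (Cod A g) \<subseteq> \<Phi>" for f g
  proof -
    have "f \<in> Arr A" using that(1) unfolding short_exact_def is_kernel_def by blast
    then show ?thesis using Cod_in_Obj ASupp_extension[OF that(1)] that(2,3) by blast
  qed
  have "subcategory A {M \<in> Obj A. ASupp A M \<subseteq> \<Phi>}"
    unfolding subcategory_def using sub isomorphic_subobject ASupp_zero zero_object_iff by blast
  then show ?thesis unfolding serre_subcategory_def using sub quot ext by blast
qed

lemma serre_subquotient:
  assumes "serre_subcategory A \<X>" "M \<in> \<X>" "subquotient A N M"
  shows "N \<in> \<X>"
  using assms unfolding serre_subcategory_def subquotient_def by blast

text \<open>A representative that is a subquotient of some \<open>M \<in> \<X>\<close> lies in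
  \<open>\<X>\<close> itself, so its own support is one of those united.\<close>

lemma open_atoms_of_serre:
  assumes S: "serre_subcategory A \<X>"
  shows "open_atoms A (\<Union>M\<in>\<X>. ASupp A M)"
proof -
  have "\<exists>H \<in> \<alpha>. ASupp A H \<subseteq> (\<Union>M\<in>\<X>. ASupp A M)" if "\<alpha> \<in> ASupp A M" "M \<in> \<X>" for \<alpha> M
    using that serre_subquotient[OF S] unfolding ASupp_def[of A M] by blast
  then show ?thesis unfolding open_atoms_def by (auto simp: ASupp_def)
qed

text \<open>Openness supplies a representative \<open>H\<close> of the atom with support inside
  \<open>\<Phi>\<close>, and the atom lies in the support of \<open>H\<close> because
  \<open>H\<close> is a subquotient of itself.\<close>

lemma union_ASupp_of_open:
  assumes "open_atoms A \<Phi>"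
  shows "(\<Union>M\<in>{M \<in> Obj A. ASupp A M \<subseteq> \<Phi>}. ASupp A M) = \<Phi>"
proof (intro subset_antisym subsetI)
  fix \<alpha> assume \<alpha>: "\<alpha> \<in> \<Phi>"
  then obtain H where H: "H \<in> \<alpha>" "ASupp A H \<subseteq> \<Phi>" and a: "\<alpha> \<in> ASpec A"
    using assms unfolding open_atoms_def by blast
  have "H \<in> Obj A" using atom_monoform[OF a H(1)] unfolding monoform_def by blast
  moreover from this have "\<alpha> \<in> ASupp A H" unfolding ASupp_def using H a subquotient_refl by blast
  ultimately show "\<alpha> \<in> (\<Union>M\<in>{M \<in> Obj A. ASupp A M \<subseteq> \<Phi>}. ASupp A M)" using H by blast
qed blast

end

section \<open>Noetherian induction\<close>

context noetherian_abelian_category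
begin

text \<open>The kernels of the composites \<open>Q 0 \<rightarrow> Q n\<close> ascend in the
  noetherian object \<open>Q 0\<close>. Where two consecutive kernels agree, \<open>e n\<close> is
  split monic.\<close>

lemma no_infinite_quotient_chain:
  fixes Q :: "nat \<Rightarrow> 'a" and e :: "nat \<Rightarrow> 'b"
  assumes e: "\<And>n. e n \<in> Hom A (Q n) (Q (Suc n))" "\<And>n. epic A (e n)" "\<And>n. \<not> monic A (e n)"
  shows False
proof -
  \<comment> \<open>\<open>p n\<close> is the composite of the first \<open>n\<close> arrows,
    starting from the identity.\<close>
  define p where "p = rec_nat (ident A (Q 0)) (\<lambda>n f. e n \<cdot> f)"
  have p0: "p 0 = ident A (Q 0)" and pS: "p (Suc n) = e n \<cdot> p n" for n by (simp_all add: p_def)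
  have Q0: "Q 0 \<in> Obj A" using HomD[OF e(1)] by blast
  have p: "p n \<in> Hom A (Q 0) (Q n) \<and> epic A (p n)" for n
  proof (induction n)
    case 0 show ?case using p0 Q0 ident_in_Hom epic_ident by simp
  next
    case (Suc n)
    then show ?case using comp_in_Hom[OF _ e(1)] epic_comp[OF _ e(2) _ e(1)] unfolding pS by blast
  qed
  have "\<forall>n. \<exists>k. is_kernel A k (p n)" using p kernel_exists HomD by metis
  then obtain k where k: "\<And>n. is_kernel A (k n) (p n)" by metis
  have kh: "k n \<in> Hom A (Dom A (k n)) (Q 0)" "p n \<cdot> k n = zero_arr A (Dom A (k n)) (Q n)" for n
    using kernel_dom[OF k] p by blast+
  have "sub_le A (k n) (k (Suc n))" for n
  proof -
    have "p (Suc n) \<cdot> k n = e n \<cdot> (p n \<cdot> k n)" using pS comp_assoc[OF kh(1) _ e(1)] p by metis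
    also have "\<dots> = zero_arr A (Dom A (k n)) (Q (Suc n))" using kh(2) comp_zero[OF e(1)] HomD[OF kh(1)] by simp
    finally show ?thesis using kernel_lift[OF k _ kh(1)] p unfolding sub_le_def by metis
  qed
  moreover have "monic A (k n) \<and> Cod A (k n) = Q 0" for n using kernel_monic[OF k] HomD[OF kh(1)] by blast
  ultimately obtain n where n: "sub_le A (k (Suc n)) (k n)"
    using noetherian[OF Q0] unfolding noetherian_object_def by (meson le_Suc_eq order_refl)
  obtain s where s: "s \<in> Hom A (Dom A (k (Suc n))) (Dom A (k n))" "k n \<cdot> s = k (Suc n)"
    using n unfolding sub_le_def by blast
  have pn: "p n \<in> Hom A (Q 0) (Q n)" "epic A (p n)" and pSn: "p (Suc n) \<in> Hom A (Q 0) (Q (Suc n))" "epic A (p (Suc n))"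
    using p by blast+
  have Qn: "Q n \<in> Obj A" using HomD[OF e(1)] by blast
  have "p n \<cdot> k (Suc n) = zero_arr A (Dom A (k (Suc n))) (Q n)"
    using comp_assoc[OF s(1) kh(1) pn(1)] s(2) kh(2) zero_comp[OF s(1) Qn] by simp
  \<comment> \<open>\<open>p n\<close> kills the kernel of \<open>p (Suc n)\<close>, so it factors
    through \<open>p (Suc n)\<close>; the factor \<open>h\<close> is a left inverse of
    \<open>e n\<close>.\<close>
  then obtain h where h: "h \<in> Hom A (Q (Suc n)) (Q n)" "h \<cdot> p (Suc n) = p n"
    using epic_factor[OF pSn(2,1) k pn(1)] by blast
  have "(h \<cdot> e n) \<cdot> p n = ident A (Q n) \<cdot> p n"
    using comp_assoc[OF pn(1) e(1) h(1)] h(2) pS ident_left[OF pn(1)] by simp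
  then have "h \<cdot> e n = ident A (Q n)"
    using epic_cancel[OF pn(2,1) comp_in_Hom[OF e(1) h(1)] ident_in_Hom[OF Qn]] by blast
  then show False using split_monic[OF e(1) h(1)] e(3) by blast
qed

text \<open>A proper quotient is an epic arrow that is not monic. A counterexample would have a
  proper quotient that is again a counterexample, and dependent choice would give an infinite
  chain.\<close>

lemma proper_quotient_induct [consumes 1, case_names step]:
  assumes M: "M \<in> Obj A"
    and step: "\<And>M. M \<in> Obj A \<Longrightarrow>
      (\<And>N e. e \<in> Hom A M N \<Longrightarrow> epic A e \<Longrightarrow> \<not> monic A e \<Longrightarrow> P N) \<Longrightarrow> P M"
  shows "P M"
proof (rule ccontr)
  assume "\<not> P M"
  have ex: "\<exists>Y. (Y \<in> Obj A \<and> \<not> P Y) \<and> (\<exists>e \<in> Hom A X Y. epic A e \<and> \<not> monic A e)"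
    if "X \<in> Obj A \<and> \<not> P X" for X
    using step[of X] that HomD by metis
  obtain Q where "\<And>n. \<exists>e \<in> Hom A (Q n) (Q (Suc n)). epic A e \<and> \<not> monic A e"
    using dependent_nat_choice[of "\<lambda>_ X. X \<in> Obj A \<and> \<not> P X" "\<lambda>_ X Y. \<exists>e \<in> Hom A X Y. epic A e \<and> \<not> monic A e"]
      M \<open>\<not> P M\<close> ex by metis
  then obtain e where "\<And>n. e n \<in> Hom A (Q n) (Q (Suc n))" "\<And>n. epic A (e n)" "\<And>n. \<not> monic A (e n)"
    by metis
  then show False using no_infinite_quotient_chain by blast
qed

text \<open>Dividing out a nonzero subobject gives a proper quotient, to which the induction
  hypothesis applies.\<close>

lemma cokernel_not_monic:
  assumes "is_cokernel A c i" "i \<in> Hom A X Y" "monic A i" "\<not> zero_object A X"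
  shows "\<not> monic A c"
  using monic_annihilated_zero[OF assms(3,2)] cokernel_cod[OF assms(1,2)] assms(4) by blast

text \<open>
  If a nonzero \<open>L\<close> embeds both into \<open>M\<close> and into \<open>Q\<close> and is not monoform, then
  some nonzero \<open>L' \<subseteq> L\<close> also embeds into a proper quotient of \<open>Q\<close>; hence the induction is on \<open>Q\<close>.
\<close>

lemma monoform_subobject_exists_aux:
  assumes "Q \<in> Obj A" and "\<not> zero_object A L" "subobject A L Q" "subobject A L M"
  shows "\<exists>H. monoform A H \<and> subobject A H M"
  using assms
proof (induction Q arbitrary: L rule: proper_quotient_induct)
  case (step Q)
  note L = step(3-5)
  obtain l where l: "l \<in> Hom A L Q" "monic A l" using L unfolding subobject_def by blast
  show ?case
  proof (cases "monoform A L")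
    case False
    then obtain i c L' where i: "monic A i" "Cod A i = L" "\<not> zero_object A (Dom A i)" "is_cokernel A c i"
      and L': "\<not> zero_object A L'" "subobject A L' L" "subobject A L' (Cod A c)"
      unfolding monoform_def using L HomD[OF l(1)] by blast
    have ih: "i \<in> Hom A (Dom A i) L" using i unfolding monic_def Hom_def by blast
    have li: "l \<cdot> i \<in> Hom A (Dom A i) Q" using comp_in_Hom[OF ih l(1)] .
    \<comment> \<open>The proper quotient of \<open>Q\<close> divides by the subobject of
      \<open>L\<close> at which monoformity fails; the corresponding quotient of \<open>L\<close>,
      and with it \<open>L'\<close>, embeds there.\<close>
    obtain d where d: "is_cokernel A d (l \<cdot> i)" using cokernel_exists HomD[OF li] by blast
    have dh: "d \<in> Hom A Q (Cod A d)" using cokernel_cod[OF d li] by blast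
    have "subobject A (Cod A c) (Cod A d)"
      unfolding subobject_def using quotient_of_subobject[OF i(1) ih l(2,1) i(4) d] .
    then have L'd: "subobject A L' (Cod A d)" "subobject A L' M"
      using subobject_trans[OF L'(3)] subobject_trans[OF L'(2) L(3)] by blast+
    have "\<not> monic A d" using cokernel_not_monic[OF d li monic_comp[OF i(1) l(2) ih l(1)] i(3)] .
    from step(2)[OF dh cokernel_epic[OF d] this L'(1) L'd] show ?thesis .
  qed (use L in blast)
qed

text \<open>The induction starts with \<open>Q\<close> and \<open>L\<close> both equal to
  \<open>M\<close>.\<close>

lemma monoform_subobject_exists:
  assumes "M \<in> Obj A" "\<not> zero_object A M"
  shows "\<exists>H. monoform A H \<and> subobject A H M"
  using monoform_subobject_exists_aux[OF assms] subobject_refl[OF assms(1)] by blast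

lemma serre_membership:
  assumes S: "serre_subcategory A \<X>" and "M \<in> Obj A" "ASupp A M \<subseteq> (\<Union>N\<in>\<X>. ASupp A N)"
  shows "M \<in> \<X>"
  using assms(2,3)
proof (induction M rule: proper_quotient_induct)
  case (step M)
  show ?case
  proof (cases "zero_object A M")
    case True
    then show ?thesis using S unfolding serre_subcategory_def subcategory_def by blast
  next
    case False
    then obtain H where H: "monoform A H" "subobject A H M" using monoform_subobject_exists step(1) by blast
    let ?\<alpha> = "atom_equiv A `` {H}"
    have "?\<alpha> \<in> ASpec A" unfolding ASpec_def using H(1) by (simp add: quotientI)
    moreover have "H \<in> ?\<alpha>" using equiv_class_self[OF equiv_atom_equiv] H(1) by simp
    ultimately have "?\<alpha> \<in> ASupp A M" unfolding ASupp_def using subobject_subquotient[OF H(2)] by blast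
    then obtain N H' where N: "N \<in> \<X>" "subquotient A H' N" and "(H, H') \<in> atom_equiv A"
      using step(3) unfolding ASupp_def by blast
    then obtain L where L: "\<not> zero_object A L" "subobject A L H" "subobject A L H'"
      unfolding atom_equiv_def by blast
    \<comment> \<open>The class of \<open>H\<close> also has the representative \<open>H'\<close>, a
      subquotient of \<open>N \<in> \<X>\<close>; its subobject \<open>L\<close> inherits
      membership.\<close>
    have LX: "L \<in> \<X>" using serre_subquotient[OF S] N L(3) subobject_subquotient by blast
    obtain i where i: "i \<in> Hom A L M" "monic A i"
      using subobject_trans[OF L(2) H(2)] unfolding subobject_def by blast
    obtain c where c: "is_cokernel A c i" using cokernel_exists HomD[OF i(1)] by blast
    have ch: "c \<in> Hom A M (Cod A c)" using cokernel_cod[OF c i(1)] by blast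
    have "ASupp A (Cod A c) \<subseteq> (\<Union>N\<in>\<X>. ASupp A N)"
      using ASupp_quotient[OF cokernel_quotient_object[OF c i(1)]] step(3) by blast
    then have "Cod A c \<in> \<X>"
      using step(2)[OF ch cokernel_epic[OF c] cokernel_not_monic[OF c i L(1)]] by blast
    moreover have "short_exact A i c"
      unfolding short_exact_def using c monic_kernel_of_cokernel[OF i(2) c] by blast
    \<comment> \<open>\<open>M\<close> is an extension of \<open>M/L\<close> by \<open>L\<close>,
      both of which lie in \<open>\<X>\<close>.\<close>
    ultimately show ?thesis using S LX HomD[OF i(1)] unfolding serre_subcategory_def by metis
  qed
qed

lemma serre_of_union_ASupp:
  assumes "serre_subcategory A \<X>"
  shows "{M \<in> Obj A. ASupp A M \<subseteq> (\<Union>N\<in>\<X>. ASupp A N)} = \<X>"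
  using serre_membership[OF assms] assms unfolding serre_subcategory_def subcategory_def by blast

end

section \<open>The correspondence between Serre subcategories and open sets of atoms\<close>

theorem theorem1:
  fixes A :: "('o, 'm) cat_data"
  assumes "noetherian_abelian_category A"
  shows "bij_betw (\<lambda>\<X>. \<Union>M\<in>\<X>. ASupp A M) {\<X>. serre_subcategory A \<X>} {\<Phi>. open_atoms A \<Phi>} \<and>
    bij_betw (\<lambda>\<Phi>. {M \<in> Obj A. ASupp A M \<subseteq> \<Phi>}) {\<Phi>. open_atoms A \<Phi>} {\<X>. serre_subcategory A \<X>} \<and>
    (\<forall>\<X>. serre_subcategory A \<X> \<longrightarrow> {M \<in> Obj A. ASupp A M \<subseteq> (\<Union>N\<in>\<X>. ASupp A N)} = \<X>) \<and>
    (\<forall>\<Phi>. open_atoms A \<Phi> \<longrightarrow> (\<Union>M\<in>{M \<in> Obj A. ASupp A M \<subseteq> \<Phi>}. ASupp A M) = \<Phi>)"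
proof -
  interpret noetherian_abelian_category A by fact
  let ?F = "\<lambda>\<X>. \<Union>M\<in>\<X>. ASupp A M" and ?G = "\<lambda>\<Phi>. {M \<in> Obj A. ASupp A M \<subseteq> \<Phi>}"
  have "bij_betw ?F {\<X>. serre_subcategory A \<X>} {\<Phi>. open_atoms A \<Phi>}"
    by (rule bij_betw_byWitness[where f' = ?G])
      (use serre_of_union_ASupp union_ASupp_of_open open_atoms_of_serre serre_of_atoms in auto)
  moreover have "bij_betw ?G {\<Phi>. open_atoms A \<Phi>} {\<X>. serre_subcategory A \<X>}"
    by (rule bij_betw_byWitness[where f' = ?F])
      (use serre_of_union_ASupp union_ASupp_of_open open_atoms_of_serre serre_of_atoms in auto)
  ultimately show ?thesis using serre_of_union_ASupp union_ASupp_of_open by blast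
qed

end
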